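(* Assume that we have a bijective generative model $G=(E,D)$ with encoder $E:\mathbb{R}^n\to\mathbb{R}^q$ and decoder $D:\mathbb{R}^q\to\mathbb{R}^n$ (so $D$ is the inverse of $E$), used to define the similarity set $S^{\mathrm{in}}(x)=D(S(x))\subseteq\mathbb{R}^n$ for a given input $x\in\mathbb{R}^n$, where $S(x)=\{E(x)+t\cdot a : |t|\le\epsilon\}\subseteq\mathbb{R}^q$ for an attribute vector $a\in\mathbb{R}^q$ and a maximum perturbation level $\epsilon>0$. Let $R:\mathbb{R}^q\to\mathbb{R}^k$ be a representation map and $C:\mathbb{R}^k\to\mathcal{Y}$ a classifier, with smoothed versions $\widehat R$ and $\widehat C$ as defined in the context. Let the procedure CERTIFY (defined in the context) perform center smoothing with confidence $1-\alpha_{cs}$ and randomized smoothing with confidence $1-\alpha_{rs}$. If CERTIFY returns "Certified" for the input $x$, then the end-to-end model $M=\widehat C\circ\widehat R\circ E$ is individually fair for $x$ with respect to $S^{\mathrm{in}}(x)$, i.e. $$\forall x'\in S^{\mathrm{in}}(x):\quad M(x)=M(x'),$$ with probability at least $1-\alpha_{cs}-\alpha_{rs}$.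
   Context: $\mathcal{Y}$ is the set of class labels and $\|\cdot\|_2$ is the Euclidean norm. The noise levels $\sigma_{cs},\sigma_{rs}>0$ are fixed. Both smoothing procedures are based on sampling; the probabilities refer to this sampling. **Center smoothing.** For a function $g:\mathbb{R}\to\mathbb{R}^k$, center smoothing uses sampling and approximation to compute a smoothed version $\hat g:\mathbb{R}\to\mathbb{R}^k$, which maps $t$ to the center point $\hat g(t)$ of a minimum enclosing ball containing at least half of the points $r_i\sim g(t+\mathcal{N}(0,\sigma_{cs}^2))$, $i\in\{1,\dots,m\}$. Run at a point $t$ with radius $\epsilon>0$, the procedure either abstains or returns $\hat g(t)$ and a number $d_{cs}$. Performing it with confidence $1-\alpha_{cs}$ means that, provided it does not abstain, with probability at least $1-\alpha_{cs}$ one has $\|\hat g(t)-\hat g(t')\|_2\le d_{cs}$ for all $t'$ with $|t-t'|\le\epsilon$. **Smoothed representation.** For $z\in\mathbb{R}^q$ let $g_z(t)=R(z+t\cdot a)$ for $t\in\mathbb{R}$, let $\widehat{g_z}$ be the center-smoothed version of $g_z$, and define $\widehat R(z)=\widehat{g_z}(0)$. **Randomized smoothing.** The smoothed classifier $\widehat C:\mathbb{R}^k\to\mathcal{Y}$ is $\widehat C(r)=\arg\max_{c\in\mathcal{Y}}\mathbb{P}_{\varepsilon}\big(C(r+\varepsilon)=c\big)$ with $\varepsilon\sim\mathcal{N}(0,\sigma_{rs}^2 I)$. Randomized smoothing, run at a point $r\in\mathbb{R}^k$, either abstains or returns a certified radius $d_{rs}$. Performing it with confidence $1-\alpha_{rs}$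 means that, provided it does not abstain, with probability at least $1-\alpha_{rs}$ one has $\widehat C(r+\delta)=\widehat C(r)$ for all $\delta\in\mathbb{R}^k$ with $\|\delta\|_2<d_{rs}$. **Procedure CERTIFY$(E,R,C,x)$.** 1. Let $z_G=E(x)$. Obtain $r_{cs}=\widehat R(z_G)$ and $d_{cs}$ from center smoothing (of $g_{z_G}$ at $t=0$ with radius $\epsilon$). If center smoothing abstained, return "Abstain". 2. Smooth $C$ by randomized smoothing to obtain the certified radius $d_{rs}$ around $r_{cs}$. 3. If $d_{cs}<d_{rs}$, return "Certified"; else return "Not Certified". *)

theory Defs
  imports "HOL-Probability.Probability"
begin

text \<open>``With probability at least \<open>p\<close>''. The events below quantify over uncountably many points
  and need not be measurable, so the phrase is read as: a measurable event of probability at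
  least \<open>p\<close> on which \<open>P\<close> holds. For measurable \<open>P\<close> this is the usual notion
  (\<open>prob_at_least_iff\<close>), whereas \<^const>\<open>measure\<close> is \<open>0\<close> on every non-measurable set.\<close>

definition prob_at_least :: "'w measure \<Rightarrow> real \<Rightarrow> ('w \<Rightarrow> bool) \<Rightarrow> bool" where
  "prob_at_least M p P \<longleftrightarrow> (\<exists>A\<in>sets M. p \<le> measure M A \<and> (\<forall>w\<in>A. P w))"

lemma prob_at_least_iff:
  assumes "prob_space M" "{w \<in> space M. P w} \<in> sets M"
  shows "prob_at_least M p P \<longleftrightarrow> p \<le> measure M {w \<in> space M. P w}"
proof
  interpret prob_space M by fact
  assume "prob_at_least M p P"
  then obtain A where A: "A \<in> sets M" "p \<le> measure M A" "\<forall>w\<in>A. P w"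
    unfolding prob_at_least_def by blast
  have "A \<subseteq> {w \<in> space M. P w}"
    using A sets.sets_into_space by blast
  then have "measure M A \<le> measure M {w \<in> space M. P w}"
    using assms(2) by (rule finite_measure_mono)
  with A show "p \<le> measure M {w \<in> space M. P w}" by linarith
next
  assume "p \<le> measure M {w \<in> space M. P w}"
  then show "prob_at_least M p P"
    unfolding prob_at_least_def using assms(2) by blast
qed

definition latent_sim_set ::
    "(real^'n \<Rightarrow> real^'q) \<Rightarrow> real^'q \<Rightarrow> real \<Rightarrow> real^'n \<Rightarrow> (real^'q) set" where
  "latent_sim_set E a \<epsilon> x = {E x + t *\<^sub>R a | t. \<bar>t\<bar> \<le> \<epsilon>}"

definition input_sim_set ::
    "(real^'n \<Rightarrow> real^'q) \<Rightarrow> (real^'q \<Rightarrow> real^'n) \<Rightarrow> real^'q \<Rightarrow> real \<Rightarrow> real^'n \<Rightarrow> (real^'n) set" where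
  "input_sim_set E D a \<epsilon> x = D ` latent_sim_set E a \<epsilon> x"

definition half_ball :: "nat \<Rightarrow> (nat \<Rightarrow> real^'k) \<Rightarrow> real^'k \<Rightarrow> real \<Rightarrow> bool" where
  "half_ball m p c \<rho> \<longleftrightarrow> 0 \<le> \<rho> \<and> real m / 2 \<le> real (card {i \<in> {1..m}. p i \<in> cball c \<rho>})"

definition min_half_ball_center :: "nat \<Rightarrow> (nat \<Rightarrow> real^'k) \<Rightarrow> real^'k \<Rightarrow> bool" where
  "min_half_ball_center m p c \<longleftrightarrow>
     (\<exists>\<rho>. half_ball m p c \<rho> \<and> (\<forall>c' \<rho>'. half_ball m p c' \<rho>' \<longrightarrow> \<rho> \<le> \<rho>'))"

text \<open>A center of a minimum enclosing ball of half of the points need not be unique; the rule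
  \<open>ctr\<close> used to pick one is a parameter. The argument \<open>n\<close> is the realisation
  \<open>n 1, \<dots>, n m\<close> of the sampled noise, which determines the smoothed function at all points.\<close>

definition smoothed_fun ::
    "nat \<Rightarrow> ((nat \<Rightarrow> real^'k) \<Rightarrow> real^'k) \<Rightarrow> (nat \<Rightarrow> real) \<Rightarrow> (real \<Rightarrow> real^'k) \<Rightarrow> real \<Rightarrow> real^'k" where
  "smoothed_fun m ctr n g t = ctr (\<lambda>i\<in>{1..m}. g (t + n i))"

text \<open>One run of the procedure on \<open>g\<close> at \<open>t\<close> with radius \<open>\<epsilon>\<close>: \<open>None\<close> is abstention, and \<open>bnd\<close> is
  the (seed-dependent) computation of the number returned together with the center.\<close>

definition center_smoothing ::
    "nat \<Rightarrow> ((nat \<Rightarrow> real^'k) \<Rightarrow> real^'k) \<Rightarrow> (nat \<Rightarrow> real)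
      \<Rightarrow> ((real \<Rightarrow> real^'k) \<Rightarrow> real \<Rightarrow> real \<Rightarrow> real option)
      \<Rightarrow> (real \<Rightarrow> real^'k) \<Rightarrow> real \<Rightarrow> real \<Rightarrow> ((real^'k) \<times> real) option" where
  "center_smoothing m ctr n bnd g t \<epsilon> =
     map_option (\<lambda>d. (smoothed_fun m ctr n g t, d)) (bnd g t \<epsilon>)"

definition cs_confidence ::
    "'w measure \<Rightarrow> nat \<Rightarrow> ((nat \<Rightarrow> real^'k) \<Rightarrow> real^'k) \<Rightarrow> (nat \<Rightarrow> 'w \<Rightarrow> real)
      \<Rightarrow> ('w \<Rightarrow> (real \<Rightarrow> real^'k) \<Rightarrow> real \<Rightarrow> real \<Rightarrow> real option)
      \<Rightarrow> real \<Rightarrow> (real \<Rightarrow> real^'k) \<Rightarrow> real \<Rightarrow> real \<Rightarrow> bool" where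
  "cs_confidence M m ctr \<xi> bnd conf g t \<epsilon> \<longleftrightarrow>
     prob_at_least M conf (\<lambda>w.
       \<forall>r d. center_smoothing m ctr (\<lambda>i. \<xi> i w) (bnd w) g t \<epsilon> = Some (r, d) \<longrightarrow>
         (\<forall>t'. \<bar>t - t'\<bar> \<le> \<epsilon> \<longrightarrow>
           norm (smoothed_fun m ctr (\<lambda>i. \<xi> i w) g t - smoothed_fun m ctr (\<lambda>i. \<xi> i w) g t') \<le> d))"

definition line_fun :: "(real^'q \<Rightarrow> real^'k) \<Rightarrow> real^'q \<Rightarrow> real^'q \<Rightarrow> real \<Rightarrow> real^'k" where
  "line_fun R a z t = R (z + t *\<^sub>R a)"

definition smoothed_rep ::
    "nat \<Rightarrow> ((nat \<Rightarrow> real^'k) \<Rightarrow> real^'k) \<Rightarrow> (nat \<Rightarrow> real)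
      \<Rightarrow> (real^'q \<Rightarrow> real^'k) \<Rightarrow> real^'q \<Rightarrow> real^'q \<Rightarrow> real^'k" where
  "smoothed_rep m ctr n R a z = smoothed_fun m ctr n (line_fun R a z) 0"

definition gaussian_vec :: "real \<Rightarrow> (real^'k) measure" where
  "gaussian_vec \<sigma> = density lborel (\<lambda>e. ennreal (\<Prod>i\<in>UNIV. normal_density 0 \<sigma> (e $ i)))"

text \<open>The maximum is always attained (also for infinitely many labels); \<^const>\<open>arg_max\<close> fixes
  how ties are broken.\<close>

definition smoothed_classifier :: "real \<Rightarrow> (real^'k \<Rightarrow> 'y) \<Rightarrow> real^'k \<Rightarrow> 'y" where
  "smoothed_classifier \<sigma> C r =
     (ARG_MAX (\<lambda>c. measure (gaussian_vec \<sigma>) {e. C (r + e) = c}) c. True)"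

definition rs_confidence ::
    "'w measure \<Rightarrow> real \<Rightarrow> ('w \<Rightarrow> (real^'k \<Rightarrow> 'y) \<Rightarrow> real^'k \<Rightarrow> real option)
      \<Rightarrow> real \<Rightarrow> (real^'k \<Rightarrow> 'y) \<Rightarrow> real^'k \<Rightarrow> bool" where
  "rs_confidence M \<sigma> rs conf C r \<longleftrightarrow>
     prob_at_least M conf (\<lambda>w.
       \<forall>d. rs w C r = Some d \<longrightarrow>
         (\<forall>\<delta>. norm \<delta> < d \<longrightarrow> smoothed_classifier \<sigma> C (r + \<delta>) = smoothed_classifier \<sigma> C r))"

text \<open>The outcome (abstention or radius) is measurable jointly in the point and the seed, so that
  the procedure can be run at a random point.\<close>

definition rs_measurable ::
    "'w measure \<Rightarrow> ('w \<Rightarrow> (real^'k \<Rightarrow> 'y) \<Rightarrow> real^'k \<Rightarrow> real option) \<Rightarrow> (real^'k \<Rightarrow> 'y) \<Rightarrow> bool" where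
  "rs_measurable M rs C \<longleftrightarrow>
     (\<forall>B\<in>sets (borel :: real measure).
       {(r, w). w \<in> space M \<and> rs w C r \<in> Some ` B} \<in> sets (borel \<Otimes>\<^sub>M M))"

datatype verdict = Abstain | Certified | Not_Certified

text \<open>\<open>cs\<close> and \<open>rs\<close> are the two smoothing procedures with their seeds already fixed. If
  \<open>rs\<close> abstains, no radius \<open>d_rs\<close> with \<open>d_cs < d_rs\<close> is available.\<close>

definition certify ::
    "((real \<Rightarrow> real^'k) \<Rightarrow> real \<Rightarrow> real \<Rightarrow> ((real^'k) \<times> real) option)
      \<Rightarrow> ((real^'k \<Rightarrow> 'y) \<Rightarrow> real^'k \<Rightarrow> real option)
      \<Rightarrow> real^'q \<Rightarrow> real \<Rightarrow> (real^'n \<Rightarrow> real^'q) \<Rightarrow> (real^'q \<Rightarrow> real^'k) \<Rightarrow> (real^'k \<Rightarrow> 'y)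
      \<Rightarrow> real^'n \<Rightarrow> verdict" where
  "certify cs rs a \<epsilon> E R C x =
     (let z = E x in
      case cs (line_fun R a z) 0 \<epsilon> of
        None \<Rightarrow> Abstain
      | Some (r_cs, d_cs) \<Rightarrow>
          (case rs C r_cs of
             None \<Rightarrow> Not_Certified
           | Some d_rs \<Rightarrow> if d_cs < d_rs then Certified else Not_Certified))"

definition individually_fair :: "(real^'n \<Rightarrow> 'y) \<Rightarrow> (real^'n) set \<Rightarrow> real^'n \<Rightarrow> bool" where
  "individually_fair Mdl S x \<longleftrightarrow> (\<forall>x'\<in>S. Mdl x = Mdl x')"

end

(* The center returned by center smoothing is the value of the smoothed representation at x. By the
   center smoothing guarantee, moving along the attribute changes the representation by at most
   d_cs, and if d_cs < d_rs the randomized smoothing guarantee says that this does not change the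
   predicted label.  The latter guarantee is given for every fixed point only, but is applied at the
   random center.  As the two seeds are independent, Fubini's theorem transfers it, provided that
   the event "randomized smoothing is correct at r" is jointly measurable in r and the seed. This
   holds because the smoothed classifier is Borel measurable with countable range: only the
   countably many labels whose decision region has positive Lebesgue measure compete for the
   maximum, and the set of maximizers is always finite. *)

theory Submission imports Defs begin

section \<open>Disjoint events and measurability of maximizers\<close>

text \<open>With \<open>n * \<delta>\<close> above the total mass, \<open>n\<close> members of
  measure at least \<open>\<delta>\<close> would not fit disjointly into the space.\<close>

lemma (in finite_measure) finite_large_disjoint:
  assumes A: "range A \<subseteq> sets M" "disjoint_family A" and "0 < \<delta>"
  shows "finite {i. \<delta> \<le> measure M (A i)}"
proof (rule ccontr)
  assume inf: "infinite {i. \<delta> \<le> measure M (A i)}"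
  obtain n :: nat where n: "measure M (space M) < n * \<delta>"
    using ex_less_of_nat_mult[OF \<open>0 < \<delta>\<close>] by blast
  obtain F where F: "finite F" "card F = n" "F \<subseteq> {i. \<delta> \<le> measure M (A i)}"
    using infinite_arbitrarily_large[OF inf] by blast
  have "n * \<delta> \<le> (\<Sum>i\<in>F. measure M (A i))"
    using sum_bounded_below[of F \<delta> "\<lambda>i. measure M (A i)"] F by auto
  also have "\<dots> = measure M (\<Union>i\<in>F. A i)"
    using A F by (intro finite_measure_finite_Union[symmetric])
      (auto simp: disjoint_family_on_def)
  also have "\<dots> \<le> measure M (space M)"
    by (rule bounded_measure)
  finally show False
    using n by simp
qed

text \<open>Each positive measure is at least some \<open>1 / Suc n\<close>, so the index set is a
  countable union of finite sets.\<close>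

lemma (in finite_measure) countable_positive_disjoint:
  assumes "range A \<subseteq> sets M" "disjoint_family A"
  shows "countable {i. measure M (A i) \<noteq> 0}"
proof -
  have "{i. measure M (A i) \<noteq> 0} = (\<Union>n. {i. 1 / real (Suc n) \<le> measure M (A i)})"
  proof (intro set_eqI iffI)
    fix i
    assume "i \<in> {i. measure M (A i) \<noteq> 0}"
    then have "0 < measure M (A i)"
      by (simp add: zero_less_measure_iff)
    then obtain n where "1 / real (Suc n) < measure M (A i)"
      using nat_approx_posE by blast
    then show "i \<in> (\<Union>n. {i. 1 / real (Suc n) \<le> measure M (A i)})"
      by (auto intro: less_imp_le)
  next
    fix i
    assume "i \<in> (\<Union>n. {i. 1 / real (Suc n) \<le> measure M (A i)})"
    then obtain n where "1 / real (Suc n) \<le> measure M (A i)" by blast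
    moreover have "0 < 1 / real (Suc n)" by simp
    ultimately show "i \<in> {i. measure M (A i) \<noteq> 0}" by auto
  qed
  moreover have "countable {i. 1 / real (Suc n) \<le> measure M (A i)}" for n
    using finite_large_disjoint[OF assms, of "1 / real (Suc n)"] by (auto intro: countable_finite)
  ultimately show ?thesis by auto
qed

text \<open>\<^const>\<open>arg_max\<close> depends only on the set of maximizers, which ranges over the countably many
  finite subsets of \<open>L\<close>.\<close>

lemma measurable_arg_max_countable:
  fixes f :: "'y \<Rightarrow> 'a \<Rightarrow> real"
  assumes [measurable]: "\<And>c. f c \<in> borel_measurable N"
    and L: "countable L"
    and pos: "\<And>c x. c \<in> L \<Longrightarrow> 0 < f c x"
    and zero: "\<And>c x. c \<notin> L \<Longrightarrow> f c x = 0"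
    and fin: "\<And>\<delta> x. 0 < \<delta> \<Longrightarrow> finite {c. \<delta> \<le> f c x}"
  shows "(\<lambda>x. ARG_MAX (\<lambda>c. f c x) c. True) \<in> measurable N (count_space UNIV)"
    and "countable (range (\<lambda>x. ARG_MAX (\<lambda>c. f c x) c. True))"
proof -
  define h where "h x = (ARG_MAX (\<lambda>c. f c x) c. True)" for x
  have "h \<in> measurable N (count_space UNIV) \<and> countable (range h)"
  proof (cases "L = {}")
    case True
    \<comment> \<open>All values are 0 at every point, so the selected label is the same
      everywhere.\<close>
    then have "h = (\<lambda>x. ARG_MAX (\<lambda>c. 0::real) c. True)"
      using zero by (simp add: h_def fun_eq_iff)
    then show ?thesis by auto
  next
    case False
    then obtain c0 where c0: "c0 \<in> L" by blast
    define m where "m x = {c \<in> L. \<forall>d\<in>L. f d x \<le> f c x}" for x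
    \<comment> \<open>A label outside \<open>L\<close> has value 0 and loses to \<open>c0\<close>,
      so comparison with the countably many labels in \<open>L\<close> decides maximality.\<close>
    have is_max: "is_arg_max (\<lambda>c. f c x) (\<lambda>_. True) c \<longleftrightarrow> c \<in> m x" for x c
      unfolding is_arg_max_linorder m_def using pos zero c0
      by (smt (verit, best) mem_Collect_eq)
    have h: "h = (\<lambda>x. SOME c. c \<in> m x)"
      unfolding h_def arg_max_def is_max ..
    have m_range: "m x \<in> {F. finite F \<and> F \<subseteq> L}" for x
    proof -
      \<comment> \<open>Every maximizer is at least as good as \<open>c0\<close>, so
        \<open>fin\<close> applies with the positive threshold \<open>f c0 x\<close>.\<close>
      have "m x \<subseteq> {c. f c0 x \<le> f c x}" using c0 by (auto simp: m_def)
      then have "finite (m x)" using fin[OF pos[OF c0]] finite_subset by blast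
      then show ?thesis by (auto simp: m_def)
    qed
    have count: "countable {F. finite F \<and> F \<subseteq> L}"
      using L by (rule countable_Collect_finite_subset)
    have "countable ((\<lambda>F. SOME c. c \<in> F) ` {F. finite F \<and> F \<subseteq> L})"
      using count by simp
    moreover have "range h \<subseteq> (\<lambda>F. SOME c. c \<in> F) ` {F. finite F \<and> F \<subseteq> L}"
      using m_range by (auto simp: h)
    ultimately have "countable (range h)"
      using countable_subset by blast
    moreover have "m \<in> measurable N (count_space {F. finite F \<and> F \<subseteq> L})"
      unfolding measurable_count_space_eq_countable[OF count]
    proof (intro conjI ballI)
      show "m \<in> space N \<rightarrow> {F. finite F \<and> F \<subseteq> L}" using m_range by blast
      fix F
      assume F: "F \<in> {F. finite F \<and> F \<subseteq> L}"
      \<comment> \<open>Membership in \<open>m x\<close> is prescribed label by label, which turns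
        the preimage into countably many comparisons of measurable functions.\<close>
      have "m -` {F} \<inter> space N = {x \<in> space N. \<forall>c\<in>L. (\<forall>d\<in>L. f d x \<le> f c x) \<longleftrightarrow> c \<in> F}"
        using F unfolding m_def by blast
      moreover have "{x \<in> space N. \<forall>c\<in>L. (\<forall>d\<in>L. f d x \<le> f c x) \<longleftrightarrow> c \<in> F} \<in> sets N"
        using L by measurable
      ultimately show "m -` {F} \<inter> space N \<in> sets N" by (simp only:)
    qed
    then have "h \<in> measurable N (count_space UNIV)"
      unfolding h by (rule measurable_compose) simp
    ultimately show ?thesis by simp
  qed
  then show "(\<lambda>x. ARG_MAX (\<lambda>c. f c x) c. True) \<in> measurable N (count_space UNIV)"
    "countable (range (\<lambda>x. ARG_MAX (\<lambda>c. f c x) c. True))"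
    by (simp_all add: h_def[abs_def])
qed

section \<open>Gaussian noise and translated regions\<close>

lemma sets_gaussian_vec [measurable_cong, simp]: "sets (gaussian_vec \<sigma>) = sets borel"
  by (simp add: gaussian_vec_def)

lemma prob_space_gaussian_vec:
  assumes "0 < \<sigma>"
  shows "prob_space (gaussian_vec \<sigma> :: (real^'k) measure)"
proof
  have basis: "Basis = range (\<lambda>i::'k. axis i (1::real))"
    by (auto simp: Basis_vec_def)
  have inj: "inj (\<lambda>i::'k. axis i (1::real))"
    by (auto simp: inj_on_def axis_eq_axis)
  have "emeasure (gaussian_vec \<sigma> :: (real^'k) measure) (space (gaussian_vec \<sigma>))
      = (\<integral>\<^sup>+e. (\<Prod>i\<in>UNIV. ennreal (normal_density 0 \<sigma> ((e::real^'k) $ i))) \<partial>lborel)"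
    by (simp add: gaussian_vec_def emeasure_density prod_ennreal)
  \<comment> \<open>Coordinates become inner products with the standard basis, the form in which the
    Lebesgue integral of a product factorizes.\<close>
  also have "\<dots> = (\<integral>\<^sup>+e. (\<Prod>b\<in>Basis. ennreal (normal_density 0 \<sigma> ((e::real^'k) \<bullet> b))) \<partial>lborel)"
    by (simp add: basis prod.reindex[OF inj] inner_axis)
  also have "\<dots> = (\<Prod>b\<in>(Basis :: (real^'k) set). \<integral>\<^sup>+s. ennreal (normal_density 0 \<sigma> s) \<partial>lborel)"
    by (rule nn_integral_lborel_prod) auto
  also have "(\<integral>\<^sup>+s. ennreal (normal_density 0 \<sigma> s) \<partial>lborel) = 1"
    using assms by (simp add: nn_integral_eq_integral)
  finally show "emeasure (gaussian_vec \<sigma> :: (real^'k) measure) (space (gaussian_vec \<sigma>)) = 1"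
    by simp
qed

lemma emeasure_lborel_translate:
  fixes A :: "'a::euclidean_space set"
  assumes "A \<in> sets borel"
  shows "emeasure lborel {e. r + e \<in> A} = emeasure lborel A"
proof -
  have "emeasure (distr lborel borel ((+) r)) A = emeasure lborel {e. r + e \<in> A}"
    using assms by (subst emeasure_distr) (auto simp: vimage_def)
  then show ?thesis by (simp add: lborel_distr_plus)
qed

lemma emeasure_gaussian_vec:
  assumes "A \<in> sets borel"
  shows "emeasure (gaussian_vec \<sigma>) {e. r + e \<in> A}
    = (\<integral>\<^sup>+e. ennreal (\<Prod>i\<in>UNIV. normal_density 0 \<sigma> (e $ i)) * indicator A (r + e) \<partial>lborel)"
proof -
  note [measurable] = assms
  have "{e. r + e \<in> A} \<in> sets lborel" by measurable
  then show ?thesis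
    unfolding gaussian_vec_def
    by (subst emeasure_density) (auto intro!: nn_integral_cong simp: indicator_def)
qed

text \<open>By \<open>emeasure_gaussian_vec\<close>, \<open>r\<close> enters only as a parameter of
  a nonnegative integrand that is jointly measurable in \<open>r\<close> and the noise; Tonelli's
  theorem then gives measurability in \<open>r\<close>.\<close>

lemma measurable_measure_gaussian_vec:
  assumes [measurable]: "A \<in> sets borel"
  shows "(\<lambda>r::real^'k. measure (gaussian_vec \<sigma>) {e. r + e \<in> A}) \<in> borel_measurable borel"
proof -
  have vec_nth: "(\<lambda>x::real^'k. x $ i) \<in> borel_measurable borel" for i
    by (intro borel_measurable_continuous_onI continuous_intros)
  have [measurable]: "(\<lambda>p::(real^'k) \<times> (real^'k). snd p $ i) \<in> borel_measurable (borel \<Otimes>\<^sub>M lborel)" for i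
    by (rule measurable_compose[OF _ vec_nth]) simp
  have [measurable]: "(\<lambda>p::(real^'k) \<times> (real^'k). fst p + snd p) \<in> borel_measurable (borel \<Otimes>\<^sub>M lborel)"
    by (intro borel_measurable_add) simp_all
  have "(\<lambda>p. indicator A (fst p + snd p) :: ennreal) \<in> borel_measurable (borel \<Otimes>\<^sub>M lborel)"
    by (rule measurable_compose[of "\<lambda>p. fst p + snd p" _ borel]) measurable
  then show ?thesis
    unfolding measure_def emeasure_gaussian_vec[OF assms]
    by (intro borel_measurable_enn2real lborel.borel_measurable_nn_integral)
      (simp add: case_prod_beta')
qed

text \<open>The density is strictly positive, so Gaussian and Lebesgue null sets agree, and the
  latter are translation invariant. Hence the labels of probability zero are the same at every point
  \<open>r\<close>.\<close>

lemma measure_gaussian_vec_eq_0_iff: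
  fixes A :: "(real^'k) set"
  assumes "0 < \<sigma>" and A: "A \<in> sets borel"
  shows "measure (gaussian_vec \<sigma>) {e. r + e \<in> A} = 0 \<longleftrightarrow> emeasure lborel A = 0"
proof -
  note [measurable] = A
  interpret prob_space "gaussian_vec \<sigma> :: (real^'k) measure"
    using assms by (intro prob_space_gaussian_vec)
  have "0 < (\<Prod>i\<in>UNIV. normal_density 0 \<sigma> ((e::real^'k) $ i))" for e
    using assms by (intro prod_pos) (auto simp: normal_density_pos)
  then have "emeasure (gaussian_vec \<sigma>) {e. r + e \<in> A} = 0 \<longleftrightarrow> (AE e in lborel. r + e \<notin> A)"
    unfolding emeasure_gaussian_vec[OF A]
    by (subst nn_integral_0_iff_AE) (auto simp: indicator_def ennreal_eq_0_iff simp flip: not_less)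
  also have "\<dots> \<longleftrightarrow> emeasure lborel {e. r + e \<in> A} = 0"
    by (subst AE_iff_measurable[OF _ refl]) auto
  finally show ?thesis
    by (simp add: emeasure_eq_measure emeasure_lborel_translate[OF A])
qed

section \<open>Measurability of the smoothed classifier and of the failure event\<close>

lemma smoothed_classifier_measurable_countable:
  fixes C :: "real^'k \<Rightarrow> 'y"
  assumes "0 < \<sigma>" and C: "\<And>c. C -` {c} \<in> sets borel"
  shows "smoothed_classifier \<sigma> C \<in> measurable borel (count_space UNIV)"
    and "countable (range (smoothed_classifier \<sigma> C))"
proof -
  interpret prob_space "gaussian_vec \<sigma> :: (real^'k) measure"
    using assms by (intro prob_space_gaussian_vec)
  \<comment> \<open>\<open>A r c\<close> is the noise that moves \<open>r\<close> into the region of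
    \<open>c\<close>. Defining \<open>L\<close> by Lebesgue measure makes it independent of
    \<open>r\<close>, as \<open>measurable_arg_max_countable\<close> demands.\<close>
  define A where "A r c = {e. r + e \<in> C -` {c}}" for r c
  define L where "L = {c. emeasure lborel (C -` {c}) \<noteq> 0}"
  have "A r c \<in> sets borel" for r c
  proof -
    note [measurable] = C
    show ?thesis unfolding A_def by measurable
  qed
  then have range: "range (A r) \<subseteq> sets (gaussian_vec \<sigma>)" for r by auto
  have disj: "disjoint_family (A r)" for r by (auto simp: disjoint_family_on_def A_def)
  have L_iff: "measure (gaussian_vec \<sigma>) (A r c) \<noteq> 0 \<longleftrightarrow> c \<in> L" for r c
    unfolding A_def L_def using measure_gaussian_vec_eq_0_iff[OF \<open>0 < \<sigma>\<close> C] by auto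
  have L: "countable L"
    using countable_positive_disjoint[OF range disj] by (simp add: L_iff)
  have sc: "smoothed_classifier \<sigma> C
      = (\<lambda>r. ARG_MAX (\<lambda>c. measure (gaussian_vec \<sigma>) (A r c)) c. True)"
    by (simp add: smoothed_classifier_def A_def fun_eq_iff)
  have meas: "(\<lambda>r. measure (gaussian_vec \<sigma>) (A r c)) \<in> borel_measurable borel" for c
    unfolding A_def by (intro measurable_measure_gaussian_vec C)
  have pos: "0 < measure (gaussian_vec \<sigma>) (A r c)" if "c \<in> L" for r c
    using that L_iff by (simp add: zero_less_measure_iff)
  have zero: "measure (gaussian_vec \<sigma>) (A r c) = 0" if "c \<notin> L" for r c
    using that L_iff by blast
  \<comment> \<open>At each \<open>r\<close> the events \<open>A r c\<close> are disjoint in a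
    probability space, so only finitely many reach a given positive probability.\<close>
  note * = measurable_arg_max_countable[of "\<lambda>c r. measure (gaussian_vec \<sigma>) (A r c)",
      OF meas L pos zero finite_large_disjoint[OF range disj]]
  show "smoothed_classifier \<sigma> C \<in> measurable borel (count_space UNIV)"
    unfolding sc by (rule *(1))
  show "countable (range (smoothed_classifier \<sigma> C))"
    unfolding sc by (rule *(2))
qed

text \<open>For a fixed label \<open>c\<close>, the points within distance \<open>q\<close> of a
  point labelled differently form a union of open balls, which is open whatever the shape of the
  regions. Splitting by \<open>c = h r\<close> leaves a countable union.\<close>

lemma sets_not_constant_on_ball:
  fixes h :: "'a::euclidean_space \<Rightarrow> 'y"
  assumes [measurable]: "h \<in> measurable borel (count_space UNIV)"
    and count: "countable (range h)"
  shows "{r. \<exists>\<delta>. norm \<delta> < q \<and> h (r + \<delta>) \<noteq> h r} \<in> sets borel"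
proof -
  have "open {r. \<exists>\<delta>. norm \<delta> < q \<and> h (r + \<delta>) \<noteq> c}" for c
  proof -
    have "{r. \<exists>\<delta>. norm \<delta> < q \<and> h (r + \<delta>) \<noteq> c} = (\<Union>s\<in>{s. h s \<noteq> c}. ball s q)"
    proof (intro set_eqI iffI)
      fix r
      assume "r \<in> {r. \<exists>\<delta>. norm \<delta> < q \<and> h (r + \<delta>) \<noteq> c}"
      then obtain \<delta> where "norm \<delta> < q" "h (r + \<delta>) \<noteq> c" by blast
      then show "r \<in> (\<Union>s\<in>{s. h s \<noteq> c}. ball s q)"
        by (auto simp: dist_norm intro!: exI[of _ "r + \<delta>"])
    next
      fix r
      assume "r \<in> (\<Union>s\<in>{s. h s \<noteq> c}. ball s q)"
      then obtain s where "h s \<noteq> c" "norm (s - r) < q" by (auto simp: dist_norm)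
      then show "r \<in> {r. \<exists>\<delta>. norm \<delta> < q \<and> h (r + \<delta>) \<noteq> c}"
        by (auto intro!: exI[of _ "s - r"])
    qed
    moreover have "open (\<Union>s\<in>{s. h s \<noteq> c}. ball s q)" by blast
    ultimately show ?thesis by metis
  qed
  then have "h -` {c} \<inter> {r. \<exists>\<delta>. norm \<delta> < q \<and> h (r + \<delta>) \<noteq> c} \<in> sets borel" for c
    using measurable_sets[OF assms(1), of "{c}"] by (intro sets.Int) auto
  then have "(\<Union>c\<in>range h. h -` {c} \<inter> {r. \<exists>\<delta>. norm \<delta> < q \<and> h (r + \<delta>) \<noteq> c}) \<in> sets borel"
    using count by (intro sets.countable_UN') auto
  also have "(\<Union>c\<in>range h. h -` {c} \<inter> {r. \<exists>\<delta>. norm \<delta> < q \<and> h (r + \<delta>) \<noteq> c})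
      = {r. \<exists>\<delta>. norm \<delta> < q \<and> h (r + \<delta>) \<noteq> h r}"
    by auto
  finally show ?thesis .
qed

text \<open>Rational radii \<open>q\<close> separate the seed-dependent radius from the geometry of the regions.\<close>

lemma sets_rs_failure:
  fixes C :: "real^'k \<Rightarrow> 'y"
  assumes "0 < \<sigma>" and C: "\<And>c. C -` {c} \<in> sets borel" and rs: "rs_measurable M rs C"
  shows "{(r, w). w \<in> space M \<and> (\<exists>d \<delta>. rs w C r = Some d \<and> norm \<delta> < d \<and>
      smoothed_classifier \<sigma> C (r + \<delta>) \<noteq> smoothed_classifier \<sigma> C r)} \<in> sets (borel \<Otimes>\<^sub>M M)"
    (is "?F \<in> _")
proof -
  let ?h = "smoothed_classifier \<sigma> C"
  let ?U = "\<lambda>q. {r. \<exists>\<delta>. norm \<delta> < q \<and> ?h (r + \<delta>) \<noteq> ?h r}"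
  let ?V = "\<lambda>q. {(r, w). w \<in> space M \<and> rs w C r \<in> Some ` {q<..}}"
  have "?U q \<in> sets borel" for q
    using smoothed_classifier_measurable_countable[OF \<open>0 < \<sigma>\<close> C]
    by (rule sets_not_constant_on_ball)
  moreover have "?V q \<in> sets (borel \<Otimes>\<^sub>M M)" for q
    using rs by (simp add: rs_measurable_def)
  ultimately have "(\<Union>q\<in>\<rat>. (?U q \<times> space M) \<inter> ?V q) \<in> sets (borel \<Otimes>\<^sub>M M)"
    by (intro sets.countable_UN' countable_rat) auto
  also have "(\<Union>q\<in>\<rat>. (?U q \<times> space M) \<inter> ?V q) = ?F"
  proof (intro set_eqI iffI)
    fix p
    assume "p \<in> ?F"
    then obtain r w d \<delta> where p: "p = (r, w)" "w \<in> space M" "rs w C r = Some d" "norm \<delta> < d"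
      "?h (r + \<delta>) \<noteq> ?h r" by blast
    obtain q where "q \<in> \<rat>" "norm \<delta> < q" "q < d"
      using Rats_dense_in_real[OF p(4)] by blast
    with p show "p \<in> (\<Union>q\<in>\<rat>. (?U q \<times> space M) \<inter> ?V q)" by auto
  next
    fix p
    assume "p \<in> (\<Union>q\<in>\<rat>. (?U q \<times> space M) \<inter> ?V q)"
    then obtain q r w d \<delta> where p: "p = (r, w)" "w \<in> space M" "rs w C r = Some d" "q < d"
      "norm \<delta> < q" "?h (r + \<delta>) \<noteq> ?h r" by auto
    moreover have "norm \<delta> < d" using p by linarith
    ultimately show "p \<in> ?F" by blast
  qed
  finally show ?thesis .
qed

section \<open>Randomized smoothing at a random point\<close>

text \<open>The measure of \<open>X\<close> is the average of the measures of its sections, and an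
  average of numbers that are at least \<open>p\<close> is at least \<open>p\<close>.\<close>

lemma measure_pair_ge_sections:
  assumes "prob_space M" "prob_space N" and X: "X \<in> sets (M \<Otimes>\<^sub>M N)"
    and sec: "\<And>u. u \<in> space M \<Longrightarrow> p \<le> measure N (Pair u -` X)"
  shows "p \<le> measure (M \<Otimes>\<^sub>M N) X"
proof -
  interpret M: prob_space M by fact
  interpret N: prob_space N by fact
  interpret P: pair_prob_space M N ..
  have "ennreal p = (\<integral>\<^sup>+u. ennreal p \<partial>M)"
    by (simp add: M.emeasure_space_1)
  also have "\<dots> \<le> (\<integral>\<^sup>+u. emeasure N (Pair u -` X) \<partial>M)"
    using sec by (intro nn_integral_mono) (simp add: N.emeasure_eq_measure ennreal_leI)
  also have "\<dots> = ennreal (measure (M \<Otimes>\<^sub>M N) X)"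
    using N.emeasure_pair_measure_alt[OF X] by (simp add: P.emeasure_eq_measure)
  finally show ?thesis by simp
qed

text \<open>Once \<open>u\<close> is fixed, \<open>\<rho> u\<close> is a fixed point and
  \<open>conf\<close> bounds the section at \<open>u\<close>; integration over \<open>u\<close>
  gives the bound on the product.\<close>

lemma prob_at_least_rs_random_point:
  fixes C :: "real^'k \<Rightarrow> 'y"
  assumes "0 < \<sigma>" and C: "\<And>c. C -` {c} \<in> sets borel"
    and "prob_space M" "prob_space N"
    and rs: "rs_measurable N rs C"
    and conf: "\<And>r. rs_confidence N \<sigma> rs p C r"
    and [measurable]: "\<rho> \<in> borel_measurable M"
  shows "prob_at_least (M \<Otimes>\<^sub>M N) p (\<lambda>(u, v). \<forall>d \<delta>. rs v C (\<rho> u) = Some d \<longrightarrow> norm \<delta> < d \<longrightarrow>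
      smoothed_classifier \<sigma> C (\<rho> u + \<delta>) = smoothed_classifier \<sigma> C (\<rho> u))"
proof -
  interpret N: prob_space N by fact
  let ?h = "smoothed_classifier \<sigma> C"
  let ?F = "{(r, w). w \<in> space N \<and> (\<exists>d \<delta>. rs w C r = Some d \<and> norm \<delta> < d \<and>
      ?h (r + \<delta>) \<noteq> ?h r)}"
  \<comment> \<open>The events supplied by \<open>conf\<close> are chosen separately for each point
    and need not form a measurable set together. The complement \<open>X\<close> of the whole
    failure event is measurable, and each of its sections contains the event chosen for that
    point.\<close>
  define X where "X = space (M \<Otimes>\<^sub>M N) - (\<lambda>(u, v). (\<rho> u, v)) -` ?F \<inter> space (M \<Otimes>\<^sub>M N)"
  have F: "?F \<in> sets (borel \<Otimes>\<^sub>M N)"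
    using \<open>0 < \<sigma>\<close> C rs by (rule sets_rs_failure)
  have "(\<lambda>(u, v). (\<rho> u, v)) \<in> measurable (M \<Otimes>\<^sub>M N) (borel \<Otimes>\<^sub>M N)"
    by measurable
  from measurable_sets[OF this F] have X: "X \<in> sets (M \<Otimes>\<^sub>M N)"
    unfolding X_def by (rule sets.compl_sets)
  have "p \<le> measure N (Pair u -` X)" if "u \<in> space M" for u
  proof -
    obtain A where A: "A \<in> sets N" "p \<le> measure N A"
      "\<And>w. w \<in> A \<Longrightarrow> \<forall>d. rs w C (\<rho> u) = Some d \<longrightarrow>
        (\<forall>\<delta>. norm \<delta> < d \<longrightarrow> ?h (\<rho> u + \<delta>) = ?h (\<rho> u))"
      using conf[of "\<rho> u"] unfolding rs_confidence_def prob_at_least_def by blast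
    have "A \<subseteq> Pair u -` X"
    proof
      fix w
      assume "w \<in> A"
      with A(1) have "w \<in> space N" using sets.sets_into_space by blast
      with A(3)[OF \<open>w \<in> A\<close>] that show "w \<in> Pair u -` X"
        by (auto simp: X_def space_pair_measure)
    qed
    then have "measure N A \<le> measure N (Pair u -` X)"
      by (rule N.finite_measure_mono[OF _ sets_Pair1[OF X]])
    with A(2) show ?thesis by linarith
  qed
  then have "p \<le> measure (M \<Otimes>\<^sub>M N) X"
    using \<open>prob_space M\<close> \<open>prob_space N\<close> X by (rule measure_pair_ge_sections[rotated 3])
  then show ?thesis
    unfolding prob_at_least_def using X
    by (intro bexI[of _ X]) (auto simp: X_def space_pair_measure)
qed

section \<open>Combining guarantees\<close>

lemma prob_at_least_fst:
  assumes "prob_space N" and "prob_at_least M p P"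
  shows "prob_at_least (M \<Otimes>\<^sub>M N) p (\<lambda>(u, v). P u)"
proof -
  interpret N: prob_space N by fact
  obtain A where A: "A \<in> sets M" "p \<le> measure M A" "\<And>u. u \<in> A \<Longrightarrow> P u"
    using assms(2) unfolding prob_at_least_def by blast
  have "measure (M \<Otimes>\<^sub>M N) (A \<times> space N) = measure M A"
    using A(1) by (simp add: measure_def N.emeasure_pair_measure_Times N.emeasure_space_1)
  then show ?thesis
    unfolding prob_at_least_def using A by (intro bexI[of _ "A \<times> space N"]) auto
qed

text \<open>Inclusion-exclusion, with the union of the two witnessing events bounded by 1.\<close>

lemma prob_at_least_conj:
  assumes "prob_space M" "prob_at_least M p P" "prob_at_least M q Q"
  shows "prob_at_least M (p + q - 1) (\<lambda>w. P w \<and> Q w)"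
proof -
  interpret prob_space M by fact
  obtain A where A: "A \<in> sets M" "p \<le> measure M A" "\<forall>w\<in>A. P w"
    using assms(2) unfolding prob_at_least_def by blast
  obtain B where B: "B \<in> sets M" "q \<le> measure M B" "\<forall>w\<in>B. Q w"
    using assms(3) unfolding prob_at_least_def by blast
  have "measure M (A \<union> B) = measure M A + measure M B - measure M (A \<inter> B)"
    using A(1) B(1) by (intro measure_Un3) (auto simp: fmeasurable_eq_sets)
  moreover have "measure M (A \<union> B) \<le> 1" by (rule prob_le_1)
  ultimately have "p + q - 1 \<le> measure M (A \<inter> B)" using A(2) B(2) by linarith
  then show ?thesis
    unfolding prob_at_least_def using A B by (intro bexI[of _ "A \<inter> B"]) auto
qed

lemma prob_at_least_mono:
  assumes "prob_at_least M p P" "\<And>w. P w \<Longrightarrow> Q w"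
  shows "prob_at_least M p Q"
  using assms unfolding prob_at_least_def by blast

section \<open>Smoothing along the attribute line and certification\<close>

text \<open>The line function based at \<open>z + t *\<^sub>R a\<close> is the one based at
  \<open>z\<close> shifted by \<open>t\<close>. With the same noise realisation, the center
  smoothing bound in \<open>t'\<close> thus speaks about representations of shifted latent
  points.\<close>

lemma smoothed_rep_line:
  "smoothed_rep m ctr n R a (z + t *\<^sub>R a) = smoothed_fun m ctr n (line_fun R a z) t"
  by (simp add: smoothed_rep_def smoothed_fun_def line_fun_def algebra_simps)

text \<open>Makes the returned center an admissible random point for
  \<open>prob_at_least_rs_random_point\<close>.\<close>

lemma measurable_smoothed_fun:
  assumes [measurable]: "g \<in> borel_measurable borel"
    and \<xi>: "\<And>i. i \<in> {1..m} \<Longrightarrow> \<xi> i \<in> borel_measurable M"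
    and ctr: "ctr \<in> borel_measurable (Pi\<^sub>M {1..m} (\<lambda>_. borel))"
  shows "(\<lambda>u. smoothed_fun m ctr (\<lambda>i. \<xi> i u) g t) \<in> borel_measurable M"
  unfolding smoothed_fun_def
proof (rule measurable_compose[OF measurable_restrict ctr])
  fix i
  assume "i \<in> {1..m}"
  note [measurable] = \<xi>[OF this]
  show "(\<lambda>u. g (t + \<xi> i u)) \<in> borel_measurable M" by measurable
qed

text \<open>The deterministic core: both seeds are fixed and both guarantees are taken to hold for
  them.\<close>

lemma individually_fair_if_certified:
  assumes "bij E" and "D = inv E"
    and cs: "\<And>r d t'. \<lbrakk>center_smoothing m ctr n bnd (line_fun R a (E x)) 0 \<epsilon> = Some (r, d); \<bar>0 - t'\<bar> \<le> \<epsilon>\<rbrakk>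
      \<Longrightarrow> norm (smoothed_fun m ctr n (line_fun R a (E x)) 0
            - smoothed_fun m ctr n (line_fun R a (E x)) t') \<le> d"
    and rs: "\<And>d \<delta>. \<lbrakk>rs C (smoothed_rep m ctr n R a (E x)) = Some d; norm \<delta> < d\<rbrakk>
      \<Longrightarrow> smoothed_classifier \<sigma> C (smoothed_rep m ctr n R a (E x) + \<delta>)
          = smoothed_classifier \<sigma> C (smoothed_rep m ctr n R a (E x))"
    and cert: "certify (center_smoothing m ctr n bnd) rs a \<epsilon> E R C x = Certified"
  shows "individually_fair (smoothed_classifier \<sigma> C \<circ> smoothed_rep m ctr n R a \<circ> E)
    (input_sim_set E D a \<epsilon> x) x"
  unfolding individually_fair_def
proof
  fix x'
  assume "x' \<in> input_sim_set E D a \<epsilon> x"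
  then obtain t where t: "\<bar>t\<bar> \<le> \<epsilon>" "x' = D (E x + t *\<^sub>R a)"
    by (auto simp: input_sim_set_def latent_sim_set_def)
  have Ex': "E x' = E x + t *\<^sub>R a"
    using t assms(1,2) by (simp add: bij_is_surj surj_f_inv_f)
  let ?r = "smoothed_rep m ctr n R a (E x)"
  let ?r' = "smoothed_rep m ctr n R a (E x + t *\<^sub>R a)"
  \<comment> \<open>The verdict \<open>Certified\<close> arises only when neither procedure
    abstains.\<close>
  obtain d_cs d_rs where d: "bnd (line_fun R a (E x)) 0 \<epsilon> = Some d_cs"
    "rs C ?r = Some d_rs" "d_cs < d_rs"
    using cert
    by (auto simp: certify_def center_smoothing_def smoothed_rep_def Let_def
        split: option.splits if_splits)
  have "norm (?r - ?r') \<le> d_cs"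
    using cs[of _ d_cs t] d(1) t(1)
    by (simp add: center_smoothing_def smoothed_rep_line) (simp add: smoothed_rep_def)
  \<comment> \<open>The perturbation fed to randomized smoothing is \<open>?r' - ?r\<close>. The
    strict test \<open>d_cs < d_rs\<close> turns the non-strict center bound into the strict one
    required there.\<close>
  then have "norm (?r' - ?r) < d_rs"
    using d(3) by (simp add: norm_minus_commute)
  from rs[OF d(2) this]
  show "(smoothed_classifier \<sigma> C \<circ> smoothed_rep m ctr n R a \<circ> E) x
      = (smoothed_classifier \<sigma> C \<circ> smoothed_rep m ctr n R a \<circ> E) x'"
    by (simp add: Ex')
qed

theorem theorem1:
  fixes E :: "real^'n \<Rightarrow> real^'q"
    and D :: "real^'q \<Rightarrow> real^'n"
    and R :: "real^'q \<Rightarrow> real^'k"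
    and C :: "real^'k \<Rightarrow> 'y"
    and a :: "real^'q"
    and x :: "real^'n"
    and \<epsilon> \<sigma>\<^sub>c\<^sub>s \<sigma>\<^sub>r\<^sub>s \<alpha>\<^sub>c\<^sub>s \<alpha>\<^sub>r\<^sub>s :: real
    and M\<^sub>c\<^sub>s :: "'u measure"
    and M\<^sub>r\<^sub>s :: "'v measure"
    and m :: nat
    and \<xi> :: "nat \<Rightarrow> 'u \<Rightarrow> real"
    and ctr :: "(nat \<Rightarrow> real^'k) \<Rightarrow> real^'k"
    and bnd :: "'u \<Rightarrow> (real \<Rightarrow> real^'k) \<Rightarrow> real \<Rightarrow> real \<Rightarrow> real option"
    and rs :: "'v \<Rightarrow> (real^'k \<Rightarrow> 'y) \<Rightarrow> real^'k \<Rightarrow> real option"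
  assumes "bij E" and "D = inv E"
    and "0 < \<epsilon>" and "0 < \<sigma>\<^sub>c\<^sub>s" and "0 < \<sigma>\<^sub>r\<^sub>s"
    and "R \<in> borel_measurable borel"
    and "\<And>c. C -` {c} \<in> sets borel"
    and "prob_space M\<^sub>c\<^sub>s"
    and "prob_space.indep_vars M\<^sub>c\<^sub>s (\<lambda>_. borel) \<xi> {1..m}"
    and "\<And>i. i \<in> {1..m} \<Longrightarrow>
           distributed M\<^sub>c\<^sub>s lborel (\<xi> i) (\<lambda>s. ennreal (normal_density 0 \<sigma>\<^sub>c\<^sub>s s))"
    and "\<And>p. min_half_ball_center m p (ctr p)"
    and "ctr \<in> borel_measurable (Pi\<^sub>M {1..m} (\<lambda>_. borel))"
    and "cs_confidence M\<^sub>c\<^sub>s m ctr \<xi> bnd (1 - \<alpha>\<^sub>c\<^sub>s) (line_fun R a (E x)) 0 \<epsilon>"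
    and "prob_space M\<^sub>r\<^sub>s"
    and "rs_measurable M\<^sub>r\<^sub>s rs C"
    and "\<And>r. rs_confidence M\<^sub>r\<^sub>s \<sigma>\<^sub>r\<^sub>s rs (1 - \<alpha>\<^sub>r\<^sub>s) C r"
  shows "prob_at_least (M\<^sub>c\<^sub>s \<Otimes>\<^sub>M M\<^sub>r\<^sub>s) (1 - \<alpha>\<^sub>c\<^sub>s - \<alpha>\<^sub>r\<^sub>s) (\<lambda>(u, v).
           certify (center_smoothing m ctr (\<lambda>i. \<xi> i u) (bnd u)) (rs v) a \<epsilon> E R C x = Certified \<longrightarrow>
           individually_fair
             (smoothed_classifier \<sigma>\<^sub>r\<^sub>s C \<circ> smoothed_rep m ctr (\<lambda>i. \<xi> i u) R a \<circ> E)
             (input_sim_set E D a \<epsilon> x) x)"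
proof -
  interpret M: prob_space M\<^sub>c\<^sub>s by fact
  interpret N: prob_space M\<^sub>r\<^sub>s by fact
  interpret P: pair_prob_space M\<^sub>c\<^sub>s M\<^sub>r\<^sub>s ..
  let ?g = "line_fun R a (E x)"
  let ?r = "\<lambda>u. smoothed_rep m ctr (\<lambda>i. \<xi> i u) R a (E x)"
  note [measurable] = \<open>R \<in> borel_measurable borel\<close>
  have "?g \<in> borel_measurable borel"
    unfolding line_fun_def by measurable
  moreover have "\<xi> i \<in> borel_measurable M\<^sub>c\<^sub>s" if "i \<in> {1..m}" for i
    using distributed_measurable[OF assms(10)[OF that]] by simp
  ultimately have "?r \<in> borel_measurable M\<^sub>c\<^sub>s"
    unfolding smoothed_rep_def using assms(12) by (intro measurable_smoothed_fun)
  \<comment> \<open>The product measure models independent seeds: the center depends on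
    \<open>u\<close> alone, the run of randomized smoothing on \<open>v\<close>.\<close>
  with assms have "prob_at_least (M\<^sub>c\<^sub>s \<Otimes>\<^sub>M M\<^sub>r\<^sub>s) (1 - \<alpha>\<^sub>r\<^sub>s) (\<lambda>(u, v).
      \<forall>d \<delta>. rs v C (?r u) = Some d \<longrightarrow> norm \<delta> < d \<longrightarrow>
        smoothed_classifier \<sigma>\<^sub>r\<^sub>s C (?r u + \<delta>) = smoothed_classifier \<sigma>\<^sub>r\<^sub>s C (?r u))"
    by (intro prob_at_least_rs_random_point)
  \<comment> \<open>The center smoothing guarantee is lifted to the product as a cylinder event; the
    level is \<open>(1 - \<alpha>\<^sub>c\<^sub>s) + (1 - \<alpha>\<^sub>r\<^sub>s) -
    1\<close>.\<close>
  from prob_at_least_conj[OF P.prob_space_axioms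
      prob_at_least_fst[OF N.prob_space_axioms assms(13)[unfolded cs_confidence_def]] this]
  have "prob_at_least (M\<^sub>c\<^sub>s \<Otimes>\<^sub>M M\<^sub>r\<^sub>s) (1 - \<alpha>\<^sub>c\<^sub>s - \<alpha>\<^sub>r\<^sub>s) (\<lambda>w.
      (case w of (u, v) \<Rightarrow> \<forall>r d.
        center_smoothing m ctr (\<lambda>i. \<xi> i u) (bnd u) ?g 0 \<epsilon> = Some (r, d) \<longrightarrow>
        (\<forall>t'. \<bar>0 - t'\<bar> \<le> \<epsilon> \<longrightarrow> norm (smoothed_fun m ctr (\<lambda>i. \<xi> i u) ?g 0
          - smoothed_fun m ctr (\<lambda>i. \<xi> i u) ?g t') \<le> d)) \<and>
      (case w of (u, v) \<Rightarrow> \<forall>d \<delta>. rs v C (?r u) = Some d \<longrightarrow> norm \<delta> < d \<longrightarrow>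
        smoothed_classifier \<sigma>\<^sub>r\<^sub>s C (?r u + \<delta>) = smoothed_classifier \<sigma>\<^sub>r\<^sub>s C (?r u)))"
    by (simp add: algebra_simps)
  then show ?thesis
  \<comment> \<open>What remains is an implication for each single pair of seeds.\<close>
  proof (rule prob_at_least_mono, clarify)
    fix u v
    assume cs: "\<forall>r d. center_smoothing m ctr (\<lambda>i. \<xi> i u) (bnd u) ?g 0 \<epsilon> = Some (r, d) \<longrightarrow>
        (\<forall>t'. \<bar>0 - t'\<bar> \<le> \<epsilon> \<longrightarrow> norm (smoothed_fun m ctr (\<lambda>i. \<xi> i u) ?g 0
          - smoothed_fun m ctr (\<lambda>i. \<xi> i u) ?g t') \<le> d)"
      and rs: "\<forall>d \<delta>. rs v C (?r u) = Some d \<longrightarrow> norm \<delta> < d \<longrightarrow>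
        smoothed_classifier \<sigma>\<^sub>r\<^sub>s C (?r u + \<delta>) = smoothed_classifier \<sigma>\<^sub>r\<^sub>s C (?r u)"
      and cert: "certify (center_smoothing m ctr (\<lambda>i. \<xi> i u) (bnd u)) (rs v) a \<epsilon> E R C x = Certified"
    show "individually_fair
        (smoothed_classifier \<sigma>\<^sub>r\<^sub>s C \<circ> smoothed_rep m ctr (\<lambda>i. \<xi> i u) R a \<circ> E)
        (input_sim_set E D a \<epsilon> x) x"
    proof (rule individually_fair_if_certified[OF assms(1,2) _ _ cert])
      show "norm (smoothed_fun m ctr (\<lambda>i. \<xi> i u) ?g 0 - smoothed_fun m ctr (\<lambda>i. \<xi> i u) ?g t') \<le> d"
        if "center_smoothing m ctr (\<lambda>i. \<xi> i u) (bnd u) ?g 0 \<epsilon> = Some (r, d)" "\<bar>0 - t'\<bar> \<le> \<epsilon>"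
        for r d t'
        using cs that by blast
      show "smoothed_classifier \<sigma>\<^sub>r\<^sub>s C (?r u + \<delta>) = smoothed_classifier \<sigma>\<^sub>r\<^sub>s C (?r u)"
        if "rs v C (?r u) = Some d" "norm \<delta> < d" for d \<delta>
        by (rule rs[rule_format, OF that])
    qed
  qed
qed

end
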